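(* Let $u\in\mathbb{Z}_{\ge 0}^m$ be a vector of counts with $n := \sum_{j=1}^m u_j \ge 1$, let $A\in\mathbb{Z}^{d\times m}$ be a matrix whose row span contains the all-ones vector $\mathbf{1}$, and let $b = Au\in\mathbb{Z}^d$. Consider the action of the complex torus $(\mathbb{C}^\times)^d$ on $\mathbb{C}^m$ given by the matrix $nA$ with linearization $b$, and let $q\in\mathbb{C}^m$ be a point in the (Euclidean) closure of the orbit of $\mathbf{1} \in \mathbb{C}^m$ at which the moment map of this action vanishes. Then the extended MLE given $u$ for the log-linear model $\mathcal{M}_A$ is the vector with $j$th entry $$\frac{|q_j|^2}{\|q\|^2}, \qquad j = 1,\dots,m.$$ If $\mathbf{1}$ is polystable under this action, then this vector is the MLE given $u$ in $\mathcal{M}_A$.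
   Context: Torus action: for $B = (B_{ij}) \in \mathbb{Z}^{d\times m}$ and $b \in \mathbb{Z}^d$, the action of $(\mathbb{C}^\times)^d$ on $\mathbb{C}^m$ given by the matrix $B$ with linearization $b$ is $(\lambda\cdot v)_j = \lambda_1^{B_{1j}-b_1}\cdots\lambda_d^{B_{dj}-b_d}\, v_j$ for $\lambda\in(\mathbb{C}^\times)^d$, $v \in \mathbb{C}^m$. The moment map of this action is $\mu:\mathbb{C}^m\to\mathbb{C}^d$, $\mu(v) = 2\left(B v^{(2)} - \|v\|^2 b\right)$, where $v^{(2)}$ is the vector with $j$th coordinate $|v_j|^2$ and $\|\cdot\|$ is the Euclidean norm. (Here it is used with $B=nA$.) A vector $v$ is polystable if $v\neq 0$ and its orbit is closed in the Euclidean topology. Log-linear model: $\Delta_{m-1} = \{p\in\mathbb{R}^m : p_j\ge 0 \text{ for all } j,\ \sum_j p_j = 1\}$, and $\mathcal{M}_A = \{p\in\Delta_{m-1} : p_j > 0 \text{ for all } j,\ \log p \in \mathrm{rowspan}(A)\}$, where $\log$ is applied coordinatewise and the row span is over $\mathbb{R}$. The extended log-linear model $\overline{\mathcal{M}_A}$ is the closure of $\mathcal{M}_A$ in the Euclidean topology on $\mathbb{R}^m$. MLE: an MLE given $u$ in $\mathcal{M}_A$ is a maximizer over $\mathcal{M}_A$ of the likelihood function $L_u(p) = p_1^{u_1}\cdots p_m^{u_m}$ (with $0^0=1$). The extended MLE given $u$ is the maximizer of $L_u$ over $\overline{\mathcal{M}_A}$. Both are unique when they exist. *)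

theory Defs
  imports "HOL-Analysis.Analysis"
begin

(* A matrix with d rows and m columns has type "int ^ 'm ^ 'd", with CARD('d) = d and
   CARD('m) = m; the entry in row i and column j is A $ i $ j. *)

definition torus :: "(complex ^ 'd) set" where
  "torus = {l. \<forall>i. l $ i \<noteq> 0}"

definition torus_act ::
  "int ^ 'm ^ 'd \<Rightarrow> int ^ 'd \<Rightarrow> complex ^ 'd \<Rightarrow> complex ^ 'm \<Rightarrow> complex ^ 'm" where
  "torus_act B b l v = (\<chi> j. (\<Prod>i\<in>UNIV. (l $ i) powi (B $ i $ j - b $ i)) * v $ j)"

definition torus_orbit :: "int ^ 'm ^ 'd \<Rightarrow> int ^ 'd \<Rightarrow> complex ^ 'm \<Rightarrow> (complex ^ 'm) set" where
  "torus_orbit B b v = (\<lambda>l. torus_act B b l v) ` torus"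

definition moment_map :: "int ^ 'm ^ 'd \<Rightarrow> int ^ 'd \<Rightarrow> complex ^ 'm \<Rightarrow> complex ^ 'd" where
  "moment_map B b v =
     (\<chi> i. 2 * ((\<Sum>j\<in>UNIV. of_int (B $ i $ j) * of_real ((norm (v $ j))\<^sup>2))
               - of_real ((norm v)\<^sup>2) * of_int (b $ i)))"

definition polystable :: "int ^ 'm ^ 'd \<Rightarrow> int ^ 'd \<Rightarrow> complex ^ 'm \<Rightarrow> bool" where
  "polystable B b v \<longleftrightarrow> v \<noteq> 0 \<and> closed (torus_orbit B b v)"

definition rowspan :: "int ^ 'm ^ 'd \<Rightarrow> (real ^ 'm) set" where
  "rowspan A = span (rows (map_matrix real_of_int A))"

definition prob_simplex :: "(real ^ 'm) set" where
  "prob_simplex = {p. (\<forall>j. 0 \<le> p $ j) \<and> (\<Sum>j\<in>UNIV. p $ j) = 1}"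

definition loglinear_model :: "int ^ 'm ^ 'd \<Rightarrow> (real ^ 'm) set" where
  "loglinear_model A =
     {p \<in> prob_simplex. (\<forall>j. 0 < p $ j) \<and> (\<chi> j. ln (p $ j)) \<in> rowspan A}"

definition extended_loglinear_model :: "int ^ 'm ^ 'd \<Rightarrow> (real ^ 'm) set" where
  "extended_loglinear_model A = closure (loglinear_model A)"

definition likelihood :: "nat ^ 'm \<Rightarrow> real ^ 'm \<Rightarrow> real" where
  "likelihood u p = (\<Prod>j\<in>UNIV. (p $ j) ^ (u $ j))"

definition is_MLE :: "int ^ 'm ^ 'd \<Rightarrow> nat ^ 'm \<Rightarrow> real ^ 'm \<Rightarrow> bool" where
  "is_MLE A u p \<longleftrightarrow> is_arg_max (likelihood u) (\<lambda>p. p \<in> loglinear_model A) p"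

definition is_extended_MLE :: "int ^ 'm ^ 'd \<Rightarrow> nat ^ 'm \<Rightarrow> real ^ 'm \<Rightarrow> bool" where
  "is_extended_MLE A u p \<longleftrightarrow>
     is_arg_max (likelihood u) (\<lambda>p. p \<in> extended_loglinear_model A) p"

end

theory Submission
  imports Defs
begin

text \<open>
  Write \<open>r\<close> for the normalised vector of squared absolute values of \<open>q\<close>. Normalised squared absolute
  values of orbit points lie in the model, so \<open>r\<close> lies in its closure. Vanishing of the moment map
  says \<open>A r = A u / n\<close>, so on the model, whose logarithms are in the row span, the likelihood of \<open>u\<close>
  equals that of the weights \<open>n r\<close>. This persists on the closure by continuity, and there Gibbs'
  inequality makes \<open>r\<close> the only maximiser.
\<close>

section \<open>Gibbs' inequality with strictness\<close>

text \<open>The exponentiated form of Gibbs' inequality, from \<open>ln x \<le> x - 1\<close> with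
  equality only at 1. Products instead of sums of logarithms let \<open>p\<close> vanish on the
  support of \<open>r\<close>; \<open>c\<close> will be the sample size.\<close>

lemma gibbs_inequality_strict:
  fixes p r :: "real ^ 'm"
  assumes p: "p \<in> prob_simplex" and r: "r \<in> prob_simplex" and "p \<noteq> r" and c: "0 < c"
  shows "(\<Prod>j | 0 < r $ j. (p $ j) powr (c * r $ j)) < (\<Prod>j | 0 < r $ j. (r $ j) powr (c * r $ j))"
proof -
  define S where "S = {j. 0 < r $ j}"
  have p0: "0 \<le> p $ j" and r0: "0 \<le> r $ j" for j
    using p r by (auto simp: prob_simplex_def)
  have p1: "(\<Sum>j\<in>UNIV. p $ j) = 1" and r1: "(\<Sum>j\<in>UNIV. r $ j) = 1"
    using p r by (auto simp: prob_simplex_def)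
  have r_out: "r $ j = 0" if "j \<notin> S" for j
    using that r0[of j] by (simp add: S_def)
  have rS: "(\<Sum>j\<in>S. r $ j) = 1"
    unfolding r1[symmetric] by (rule sum.mono_neutral_left) (auto simp: r_out)
  \<comment> \<open>The mass of \<open>p\<close> off the support of \<open>r\<close> is kept, since
    it must be shown to vanish in the equality case.\<close>
  have p_split: "(\<Sum>j\<in>S. p $ j) + (\<Sum>j\<in>-S. p $ j) = 1"
    unfolding p1[symmetric] Compl_eq_Diff_UNIV
    by (subst sum.subset_diff[of S UNIV]) (auto simp: add.commute)
  have rpos: "0 < r $ j" if "j \<in> S" for j
    using that by (simp add: S_def)
  have rprod: "0 < (\<Prod>j\<in>S. (r $ j) powr (c * r $ j))"
    by (rule prod_pos) (use rpos in force)
  have "(\<Prod>j\<in>S. (p $ j) powr (c * r $ j)) < (\<Prod>j\<in>S. (r $ j) powr (c * r $ j))"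
  proof (cases "\<exists>j\<in>S. p $ j = 0")
    case True
    then have "(\<Prod>j\<in>S. (p $ j) powr (c * r $ j)) = 0"
      by (intro prod_zero) auto
    then show ?thesis
      using rprod by (simp only:)
  next
    case False
    then have ppos: "0 < p $ j" if "j \<in> S" for j
      using that p0[of j] by (metis order_le_less)
    \<comment> \<open>The slack in \<open>ln x \<le> x - 1\<close> at
      \<open>x = p $ j / r $ j\<close>, scaled by \<open>r $ j\<close>.\<close>
    define g where "g j = p $ j - r $ j - r $ j * ln (p $ j / r $ j)" for j
    have g0: "0 \<le> g j" and g_eq: "g j = 0 \<Longrightarrow> p $ j = r $ j" if "j \<in> S" for j
    proof -
      have pos: "0 < p $ j / r $ j"
        using ppos rpos that by simp
      have g_alt: "g j = r $ j * (p $ j / r $ j - 1 - ln (p $ j / r $ j))"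
        using rpos[OF that] by (simp add: g_def right_diff_distrib)
      show "0 \<le> g j"
        unfolding g_alt using ln_le_minus_one[OF pos] rpos[OF that] by simp
      assume "g j = 0"
      then have "p $ j / r $ j = 1"
        using ln_eq_minus_one[OF pos] rpos[OF that] unfolding g_alt by simp
      then show "p $ j = r $ j"
        using rpos[OF that] by simp
    qed
    have neg: "(\<Sum>j\<in>S. r $ j * ln (p $ j / r $ j)) < 0"
    \<comment> \<open>The total slack plus the mass of \<open>p\<close> outside \<open>S\<close> is
      minus the logarithmic sum. If that sum were nonnegative, both nonnegative quantities would be
      zero, forcing \<open>p = r\<close>.\<close>
    proof (rule ccontr)
      assume "\<not> ?thesis"
      moreover have "sum g S = (\<Sum>j\<in>S. p $ j) - 1 - (\<Sum>j\<in>S. r $ j * ln (p $ j / r $ j))"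
        by (simp add: g_def sum_subtractf rS)
      moreover have out: "0 \<le> (\<Sum>j\<in>-S. p $ j)" and "0 \<le> sum g S"
        using p0 g0 by (auto intro: sum_nonneg)
      ultimately have "sum g S = 0" and "(\<Sum>j\<in>-S. p $ j) = 0"
        using p_split by linarith+
      then have "\<forall>j\<in>S. g j = 0" and "\<forall>j\<in>-S. p $ j = 0"
        using g0 p0 by (simp_all add: sum_nonneg_eq_0_iff)
      then have "p = r"
        using g_eq r_out by (metis ComplI vec_eq_iff)
      with \<open>p \<noteq> r\<close> show False ..
    qed
    have "(\<Prod>j\<in>S. (p $ j) powr (c * r $ j))
        = (\<Prod>j\<in>S. exp (c * (r $ j * ln (p $ j / r $ j))) * (r $ j) powr (c * r $ j))"
    proof (rule prod.cong)
      fix j assume "j \<in> S"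
      then show "(p $ j) powr (c * r $ j)
          = exp (c * (r $ j * ln (p $ j / r $ j))) * (r $ j) powr (c * r $ j)"
        using ppos[of j] rpos[of j]
        by (simp add: powr_def ln_div algebra_simps flip: exp_add)
    qed simp
    also have "\<dots> = exp (c * (\<Sum>j\<in>S. r $ j * ln (p $ j / r $ j)))
        * (\<Prod>j\<in>S. (r $ j) powr (c * r $ j))"
      by (simp add: prod.distrib exp_sum sum_distrib_left)
    also have "\<dots> < (\<Prod>j\<in>S. (r $ j) powr (c * r $ j))"
      using neg c rprod by (simp add: mult_pos_neg)
    finally show ?thesis .
  qed
  then show ?thesis
    by (simp add: S_def)
qed

section \<open>Likelihood on the extended model\<close>

text \<open>By linearity it suffices to take \<open>x\<close> a row of \<open>A\<close>, where the
  two inner products are matching coordinates of the two matrix-vector products.\<close>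

lemma inner_rowspan_eq:
  fixes A :: "int ^ 'm ^ 'd" and x y z :: "real ^ 'm"
  assumes "x \<in> rowspan A"
    and "map_matrix real_of_int A *v y = map_matrix real_of_int A *v z"
  shows "x \<bullet> y = x \<bullet> z"
  using assms(1) unfolding rowspan_def
proof (induction rule: span_induct)
  case base
  show ?case
    by (auto simp: subspace_def inner_add_left)
next
  case (step x)
  then obtain i where "x = row i (map_matrix real_of_int A)"
    by (auto simp: rows_def)
  moreover have "(map_matrix real_of_int A *v y) $ i = (map_matrix real_of_int A *v z) $ i"
    using assms(2) by simp
  ultimately show ?case
    by (simp add: row_def matrix_vector_mult_def inner_vec_def)
qed

lemma closed_prob_simplex: "closed (prob_simplex :: (real ^ 'm) set)"
  unfolding prob_simplex_def Collect_conj_eq Collect_all_eq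
  by (intro closed_Int closed_INT ballI closed_Collect_le closed_Collect_eq continuous_intros)

lemma extended_loglinear_model_subset: "extended_loglinear_model A \<subseteq> prob_simplex"
  unfolding extended_loglinear_model_def
  by (intro closure_minimal closed_prob_simplex) (auto simp: loglinear_model_def)

lemma loglinear_model_subset_extended: "loglinear_model A \<subseteq> extended_loglinear_model A"
  unfolding extended_loglinear_model_def by (rule closure_subset)

text \<open>The product runs over the support of \<open>r\<close> because \<open>0 powr 0 = 0\<close>.\<close>

lemma likelihood_eq_prod_powr:
  fixes A :: "int ^ 'm ^ 'd" and u :: "nat ^ 'm" and r p :: "real ^ 'm"
  assumes p: "p \<in> extended_loglinear_model A"
    and r: "\<And>j. 0 \<le> r $ j"
    and eq: "map_matrix real_of_int A *v (\<chi> j. real (u $ j)) = map_matrix real_of_int A *v r"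
  shows "likelihood u p = (\<Prod>j | 0 < r $ j. (p $ j) powr (r $ j))"
proof -
  define F where "F x = (\<Prod>j | 0 < r $ j. (x $ j) powr (r $ j))" for x :: "real ^ 'm"
  \<comment> \<open>On the model, the log-likelihood pairs the weights with a vector of the row
    span, so it sees them only through their image under \<open>A\<close>.\<close>
  have model: "likelihood u x = F x" if "x \<in> loglinear_model A" for x
  proof -
    have x0: "0 < x $ j" for j
      using that by (simp add: loglinear_model_def)
    have "(\<chi> j. ln (x $ j)) \<bullet> (\<chi> j. real (u $ j)) = (\<chi> j. ln (x $ j)) \<bullet> r"
      using that by (intro inner_rowspan_eq[OF _ eq]) (simp add: loglinear_model_def)
    then have ln_eq: "(\<Sum>j\<in>UNIV. real (u $ j) * ln (x $ j)) = (\<Sum>j\<in>UNIV. r $ j * ln (x $ j))"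
      by (simp add: inner_vec_def mult.commute)
    have "likelihood u x = (\<Prod>j\<in>UNIV. exp (real (u $ j) * ln (x $ j)))"
      unfolding likelihood_def using x0 by (simp add: exp_of_nat_mult)
    also have "\<dots> = exp (\<Sum>j\<in>UNIV. r $ j * ln (x $ j))"
      by (simp add: exp_sum flip: ln_eq)
    also have "(\<Sum>j\<in>UNIV. r $ j * ln (x $ j)) = (\<Sum>j | 0 < r $ j. r $ j * ln (x $ j))"
      by (rule sum.mono_neutral_right) (use r in \<open>auto simp: order_le_less\<close>)
    also have "exp \<dots> = F x"
      unfolding F_def using x0 by (simp add: exp_sum powr_def less_imp_neq[THEN not_sym])
    finally show ?thesis .
  qed
  from p obtain x where x: "\<And>k. x k \<in> loglinear_model A" and lim: "x \<longlonglongrightarrow> p"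
    unfolding extended_loglinear_model_def closure_sequential by blast
  have "(\<lambda>k. likelihood u (x k)) \<longlonglongrightarrow> likelihood u p"
    unfolding likelihood_def by (intro tendsto_intros lim)
  \<comment> \<open>The limit \<open>p\<close> may have zero coordinates; \<open>powr\<close> is
    still continuous there along nonnegative bases because every exponent in \<open>F\<close> is
    positive.\<close>
  moreover have "(\<lambda>k. F (x k)) \<longlonglongrightarrow> F p"
    unfolding F_def
  proof (intro tendsto_prod tendsto_powr')
    fix j assume "j \<in> {j. 0 < r $ j}"
    moreover have "\<forall>\<^sub>F k in sequentially. 0 \<le> x k $ j"
      using x by (auto simp: loglinear_model_def intro!: always_eventually less_imp_le)
    ultimately show "p $ j \<noteq> 0 \<or> 0 < r $ j \<and> (\<forall>\<^sub>F k in sequentially. 0 \<le> x k $ j)"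
      by simp
  qed (auto intro!: tendsto_intros lim)
  ultimately show ?thesis
    using model x LIMSEQ_unique unfolding F_def by auto
qed

text \<open>Both likelihoods become products with exponents \<open>c * r $ j\<close> over the
  support of \<open>r\<close>, and Gibbs' inequality compares them.\<close>

lemma likelihood_less_of_moment_eq:
  fixes A :: "int ^ 'm ^ 'd" and u :: "nat ^ 'm" and r p :: "real ^ 'm"
  assumes p: "p \<in> extended_loglinear_model A" and r: "r \<in> extended_loglinear_model A"
    and "0 < c" and "p \<noteq> r"
    and eq: "map_matrix real_of_int A *v (\<chi> j. real (u $ j)) = map_matrix real_of_int A *v (c *\<^sub>R r)"
  shows "likelihood u p < likelihood u r"
proof -
  have simplex: "p \<in> prob_simplex" "r \<in> prob_simplex"
    using p r extended_loglinear_model_subset by blast+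
  then have "0 \<le> (c *\<^sub>R r) $ j" for j
    using \<open>0 < c\<close> by (simp add: prob_simplex_def)
  note L = likelihood_eq_prod_powr[OF _ this eq]
  show ?thesis
    unfolding L[OF p] L[OF r]
    using gibbs_inequality_strict[OF simplex \<open>p \<noteq> r\<close> \<open>0 < c\<close>] \<open>0 < c\<close>
    by (simp add: zero_less_mult_iff)
qed

lemma is_arg_max_iff_eq_strict_max:
  fixes f :: "'a \<Rightarrow> real"
  assumes "P r" and "\<And>x. P x \<Longrightarrow> x \<noteq> r \<Longrightarrow> f x < f r"
  shows "is_arg_max f P p \<longleftrightarrow> p = r"
  using assms unfolding is_arg_max_def by (metis less_asym)

section \<open>Orbit of the all-ones vector and its closure\<close>

definition normalized_moduli :: "complex ^ 'm \<Rightarrow> real ^ 'm" where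
  "normalized_moduli v = (\<chi> j. (norm (v $ j))\<^sup>2 / (norm v)\<^sup>2)"

lemma sum_norm_power2_nth: "(\<Sum>j\<in>UNIV. (norm (v $ j))\<^sup>2) = (norm v)\<^sup>2" for v :: "complex ^ 'm"
  by (simp add: norm_vec_def L2_set_def sum_nonneg)

text \<open>Logarithms of moduli linearise the action and forget the phases: \<open>t\<close>
  collects the \<open>ln (norm (l $ i))\<close>.\<close>

lemma torus_orbit_oneE:
  fixes B :: "int ^ 'm ^ 'd"
  assumes "v \<in> torus_orbit B b 1"
  obtains t :: "real ^ 'd" where "\<And>j. v $ j \<noteq> 0"
    and "\<And>j. ln (norm (v $ j)) = (\<Sum>i\<in>UNIV. real_of_int (B $ i $ j - b $ i) * t $ i)"
proof -
  obtain l where l: "\<And>i. l $ i \<noteq> 0" and v: "v = torus_act B b l 1"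
    using assms by (auto simp: torus_orbit_def torus_def)
  show ?thesis
  proof
    show "v $ j \<noteq> 0" for j
      using l by (simp add: v torus_act_def)
    show "ln (norm (v $ j)) = (\<Sum>i\<in>UNIV. real_of_int (B $ i $ j - b $ i) * (\<chi> i. ln (norm (l $ i))) $ i)"
      for j
      using l by (simp add: v torus_act_def norm_power_int ln_prod
          flip: prod_norm powr_real_of_int')
  qed
qed

text \<open>The log of a squared modulus is a combination of rows of \<open>A\<close>, up to the
  shifts by \<open>b\<close> and the normalisation. Those contribute multiples of \<open>1\<close>,
  which lies in the row span.\<close>

lemma normalized_moduli_in_loglinear_model:
  fixes A :: "int ^ 'm ^ 'd"
  assumes one: "(1 :: real ^ 'm) \<in> rowspan A"
    and v: "v \<in> torus_orbit (map_matrix (\<lambda>x. k * x) A) b 1"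
  shows "normalized_moduli v \<in> loglinear_model A"
proof -
  obtain t :: "real ^ 'd" where nz: "\<And>j. v $ j \<noteq> 0"
    and ln: "\<And>j. ln (norm (v $ j))
      = (\<Sum>i\<in>UNIV. real_of_int (map_matrix (\<lambda>x. k * x) A $ i $ j - b $ i) * t $ i)"
    using torus_orbit_oneE[OF v] by blast
  have "v \<noteq> 0"
    using nz by auto
  have rows: "row i (map_matrix real_of_int A) \<in> rowspan A" for i
    by (auto simp: rowspan_def rows_def intro: span_base)
  have sub: "subspace (rowspan A)"
    by (simp add: rowspan_def)
  have "(\<chi> j. ln (normalized_moduli v $ j))
      = 2 *\<^sub>R (\<Sum>i\<in>UNIV. t $ i *\<^sub>R (of_int k *\<^sub>R row i (map_matrix real_of_int A) - of_int (b $ i) *\<^sub>R 1))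
        - ln ((norm v)\<^sup>2) *\<^sub>R 1"
    using nz \<open>v \<noteq> 0\<close> ln
    by (simp add: vec_eq_iff normalized_moduli_def ln_div ln_realpow row_def algebra_simps)
  also have "\<dots> \<in> rowspan A"
    by (intro subspace_diff[OF sub] subspace_scale[OF sub] subspace_sum[OF sub] rows one)
  finally show ?thesis
    using nz \<open>v \<noteq> 0\<close>
    by (simp add: loglinear_model_def prob_simplex_def normalized_moduli_def sum_norm_power2_nth
        flip: sum_divide_distrib)
qed

text \<open>The monomial with exponent \<open>u\<close> is invariant because \<open>n A u = n b\<close>, so it separates the orbit of
  \<open>1\<close> from the origin.\<close>

lemma zero_notin_closure_torus_orbit:
  fixes A :: "int ^ 'm ^ 'd" and u :: "nat ^ 'm"
  assumes n: "n = (\<Sum>j\<in>UNIV. u $ j)" "1 \<le> n"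
    and b: "b = A *v (\<chi> j. int (u $ j))"
  shows "0 \<notin> closure (torus_orbit (map_matrix (\<lambda>x. int n * x) A) b 1)"
proof
  let ?O = "torus_orbit (map_matrix (\<lambda>x. int n * x) A) b 1"
  define F where "F v = (\<Prod>j\<in>UNIV. norm (v $ j) ^ (u $ j))" for v :: "complex ^ 'm"
  have F1: "F v = 1" if v: "v \<in> ?O" for v
  proof -
    obtain t :: "real ^ 'd" where nz: "\<And>j. v $ j \<noteq> 0"
      and ln: "\<And>j. ln (norm (v $ j))
        = (\<Sum>i\<in>UNIV. real_of_int (map_matrix (\<lambda>x. int n * x) A $ i $ j - b $ i) * t $ i)"
      using torus_orbit_oneE[OF v] by blast
    \<comment> \<open>The exponent of the \<open>i\<close>th torus coordinate in the monomial; it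
      cancels since the counts sum to \<open>n\<close> and \<open>b\<close> is \<open>A\<close>
      applied to \<open>u\<close>.\<close>
    have zero: "(\<Sum>j\<in>UNIV. real (u $ j) * real_of_int (int n * A $ i $ j - b $ i)) = 0" for i
    proof -
      have "(\<Sum>j\<in>UNIV. int (u $ j) * (int n * A $ i $ j - b $ i))
          = int n * (\<Sum>j\<in>UNIV. A $ i $ j * int (u $ j)) - (\<Sum>j\<in>UNIV. int (u $ j)) * b $ i"
        by (simp add: right_diff_distrib sum_subtractf sum_distrib_left sum_distrib_right mult_ac)
      also have "\<dots> = 0"
        by (simp add: b n matrix_vector_mult_def)
      finally have "real_of_int (\<Sum>j\<in>UNIV. int (u $ j) * (int n * A $ i $ j - b $ i)) = 0"
        by simp
      then show ?thesis
        by simp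
    qed
    have "F v = exp (\<Sum>j\<in>UNIV. real (u $ j) * ln (norm (v $ j)))"
      unfolding F_def using nz by (simp add: exp_sum exp_of_nat_mult)
    also have "(\<Sum>j\<in>UNIV. real (u $ j) * ln (norm (v $ j)))
        = (\<Sum>j\<in>UNIV. \<Sum>i\<in>UNIV. real (u $ j) * real_of_int (int n * A $ i $ j - b $ i) * t $ i)"
      by (simp add: ln sum_distrib_left mult.assoc)
    also have "\<dots> = (\<Sum>i\<in>UNIV. (\<Sum>j\<in>UNIV. real (u $ j) * real_of_int (int n * A $ i $ j - b $ i)) * t $ i)"
      by (subst sum.swap) (simp only: sum_distrib_right)
    also have "\<dots> = 0"
      by (simp only: zero) simp
    finally show ?thesis
      by simp
  qed
  assume "0 \<in> closure ?O"
  moreover have "closed {v. F v = 1}"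
    unfolding F_def by (intro closed_Collect_eq continuous_intros)
  ultimately have "F 0 = 1"
    using closure_minimal[of ?O "{v. F v = 1}"] F1 by blast
  \<comment> \<open>A positive count is essential: with \<open>0 ^ 0 = 1\<close> the empty monomial
    would be 1 at the origin too.\<close>
  moreover obtain j where "0 < u $ j"
    using n by (metis gr0I not_one_le_zero sum.neutral)
  then have "F 0 = 0"
    unfolding F_def by (intro prod_zero) auto
  ultimately show False
    by simp
qed

text \<open>Normalisation is continuous away from the origin, so it carries limits of orbit points
  to limits of model points.\<close>

lemma normalized_moduli_in_extended_loglinear_model:
  fixes A :: "int ^ 'm ^ 'd"
  assumes one: "(1 :: real ^ 'm) \<in> rowspan A"
    and q: "q \<in> closure (torus_orbit (map_matrix (\<lambda>x. k * x) A) b 1)" and "q \<noteq> 0"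
  shows "normalized_moduli q \<in> extended_loglinear_model A"
proof -
  from q obtain v where v: "\<And>i. v i \<in> torus_orbit (map_matrix (\<lambda>x. k * x) A) b 1"
    and lim: "v \<longlonglongrightarrow> q"
    unfolding closure_sequential by blast
  have "(\<lambda>i. normalized_moduli (v i)) \<longlonglongrightarrow> normalized_moduli q"
    unfolding normalized_moduli_def using \<open>q \<noteq> 0\<close> by (intro tendsto_intros lim) simp
  then show ?thesis
    unfolding extended_loglinear_model_def closure_sequential
    using normalized_moduli_in_loglinear_model[OF one v]
    by (intro exI[of _ "\<lambda>i. normalized_moduli (v i)"]) simp
qed

text \<open>Dividing the vanishing moment map by \<open>2 * (norm q)\<^sup>2\<close> gives the
  likelihood equations: observed and expected statistics agree.\<close>

lemma moment_map_eq_0_imp: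
  fixes A :: "int ^ 'm ^ 'd" and u :: "nat ^ 'm"
  assumes b: "b = A *v (\<chi> j. int (u $ j))" and "q \<noteq> 0"
    and mm: "moment_map (map_matrix (\<lambda>x. int n * x) A) b q = 0"
  shows "map_matrix real_of_int A *v (\<chi> j. real (u $ j))
    = map_matrix real_of_int A *v (real n *\<^sub>R normalized_moduli q)"
proof -
  have "real_of_int (b $ i) = (\<Sum>j\<in>UNIV. real_of_int (A $ i $ j) * (real n * ((norm (q $ j))\<^sup>2 / (norm q)\<^sup>2)))"
    for i
  proof -
    have "moment_map (map_matrix (\<lambda>x. int n * x) A) b q $ i = 0"
      using mm by simp
    then have "complex_of_real (\<Sum>j\<in>UNIV. real_of_int (int n * A $ i $ j) * (norm (q $ j))\<^sup>2)
        = complex_of_real ((norm q)\<^sup>2 * real_of_int (b $ i))"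
      by (simp add: moment_map_def)
    then have "(\<Sum>j\<in>UNIV. real_of_int (int n * A $ i $ j) * (norm (q $ j))\<^sup>2)
        = (norm q)\<^sup>2 * real_of_int (b $ i)"
      by (simp only: of_real_eq_iff)
    then have "real_of_int (b $ i)
        = (\<Sum>j\<in>UNIV. real_of_int (int n * A $ i $ j) * (norm (q $ j))\<^sup>2) / (norm q)\<^sup>2"
      using \<open>q \<noteq> 0\<close> by simp
    then show ?thesis
      by (simp add: sum_divide_distrib mult_ac)
  qed
  then show ?thesis
    by (simp add: vec_eq_iff matrix_vector_mult_def normalized_moduli_def b)
qed

theorem theorem4p7:
  fixes u :: "nat ^ 'm" and A :: "int ^ 'm ^ 'd" and n :: nat and b :: "int ^ 'd"
    and nA :: "int ^ 'm ^ 'd" and q :: "complex ^ 'm"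
  assumes "n = (\<Sum>j\<in>UNIV. u $ j)" and "1 \<le> n"
    and "(1 :: real ^ 'm) \<in> rowspan A"
    and "b = A *v (\<chi> j. int (u $ j))"
    and "nA = map_matrix (\<lambda>x. int n * x) A"
    and "q \<in> closure (torus_orbit nA b 1)"
    and "moment_map nA b q = 0"
  shows "(\<forall>p. is_extended_MLE A u p \<longleftrightarrow> p = (\<chi> j. (norm (q $ j))\<^sup>2 / (norm q)\<^sup>2)) \<and>
         (polystable nA b 1 \<longrightarrow>
           (\<forall>p. is_MLE A u p \<longleftrightarrow> p = (\<chi> j. (norm (q $ j))\<^sup>2 / (norm q)\<^sup>2)))"
proof -
  let ?r = "normalized_moduli q"
  have "q \<noteq> 0"
    using zero_notin_closure_torus_orbit[OF assms(1,2,4)] assms(5,6) by blast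
  have r: "?r \<in> extended_loglinear_model A"
    using normalized_moduli_in_extended_loglinear_model[OF assms(3)] assms(5,6) \<open>q \<noteq> 0\<close> by blast
  have less: "likelihood u p < likelihood u ?r" if "p \<in> extended_loglinear_model A" "p \<noteq> ?r" for p
    using likelihood_less_of_moment_eq[OF that(1) r _ that(2)]
      moment_map_eq_0_imp[OF assms(4) \<open>q \<noteq> 0\<close>] assms(2,5,7)
    by (metis of_nat_0_less_iff order_less_le_trans zero_less_one)
  have "is_extended_MLE A u p \<longleftrightarrow> p = ?r" for p
    unfolding is_extended_MLE_def using r less by (rule is_arg_max_iff_eq_strict_max)
  moreover have "is_MLE A u p \<longleftrightarrow> p = ?r" if "polystable nA b 1" for p
    unfolding is_MLE_def
  proof (rule is_arg_max_iff_eq_strict_max)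
    \<comment> \<open>Polystability makes the orbit equal to its closure, so the maximiser already
      lies in the model.\<close>
    have "q \<in> torus_orbit nA b 1"
      using that assms(6) by (simp add: polystable_def)
    then show "?r \<in> loglinear_model A"
      using normalized_moduli_in_loglinear_model[OF assms(3)] assms(5) by blast
    show "likelihood u x < likelihood u ?r" if "x \<in> loglinear_model A" "x \<noteq> ?r" for x
      using that less loglinear_model_subset_extended by blast
  qed
  ultimately show ?thesis
    by (simp add: normalized_moduli_def)
qed

end
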